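(* Let $D$ be a $1$-in-regular digraph. Then $D$ admits a $(1,\le 2)$-identifying code if and only if the girth of $D$ is at least $5$.
   Context: Digraphs have no loops and no multiple arcs, but may contain both arcs $(u,v)$ and $(v,u)$ (a digon, i.e. a directed cycle of length 2). For a vertex $u$, $N^-(u)=\{v:(v,u)\in A\}$ and $N^-[u]=N^-(u)\cup\{u\}$; for a vertex set $U$, $N^-[U]=\bigcup_{u\in U}N^-[u]$. A digraph is $1$-in-regular if $|N^-(u)|=1$ for every vertex $u$. The girth is the length of a shortest directed cycle. A set $C\subseteq V$ is a $(1,\le\ell)$-identifying code in $D$ if $N^-[X]\cap C\ne N^-[Y]\cap C$ for all distinct $X,Y\subseteq V$ with $1\le|X|,|Y|\le\ell$; $D$ admits such a code if some such $C$ exists. *)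

theory Defs
  imports "Graph_Theory.Arc_Walk" "HOL-Library.Extended_Nat"
begin

(* The library's locale digraph also demands finiteness; digraphs here may be infinite. *)
locale simple_digraph = loopfree_digraph + nomulti_digraph

definition in_nbhd :: "('a, 'b) pre_digraph \<Rightarrow> 'a \<Rightarrow> 'a set" where
  "in_nbhd D u = {v. v \<rightarrow>\<^bsub>D\<^esub> u}"

definition closed_in_nbhd :: "('a, 'b) pre_digraph \<Rightarrow> 'a \<Rightarrow> 'a set" where
  "closed_in_nbhd D u = insert u (in_nbhd D u)"

definition closed_in_nbhd_set :: "('a, 'b) pre_digraph \<Rightarrow> 'a set \<Rightarrow> 'a set" where
  "closed_in_nbhd_set D U = (\<Union>u\<in>U. closed_in_nbhd D u)"

definition in_regular :: "nat \<Rightarrow> ('a, 'b) pre_digraph \<Rightarrow> bool" where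
  "in_regular k D \<longleftrightarrow> (\<forall>u\<in>verts D. finite (in_nbhd D u) \<and> card (in_nbhd D u) = k)"

(* The girth of an acyclic digraph is infinity, the infimum of the empty set. *)
definition girth :: "('a, 'b) pre_digraph \<Rightarrow> enat" where
  "girth D = (INF p\<in>{p. pre_digraph.cycle D p}. enat (length p))"

(* identifying_code D l C is a (1, <= l)-identifying code. As card of an infinite
   set is 0, the lower bounds on the cardinalities make X and Y finite and nonempty. *)
definition identifying_code :: "('a, 'b) pre_digraph \<Rightarrow> nat \<Rightarrow> 'a set \<Rightarrow> bool" where
  "identifying_code D l C \<longleftrightarrow>
     C \<subseteq> verts D \<and>
     (\<forall>X Y. X \<subseteq> verts D \<and> Y \<subseteq> verts D \<and> X \<noteq> Y \<and>
            1 \<le> card X \<and> card X \<le> l \<and> 1 \<le> card Y \<and> card Y \<le> l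
        \<longrightarrow> closed_in_nbhd_set D X \<inter> C \<noteq> closed_in_nbhd_set D Y \<inter> C)"

definition admits_identifying_code :: "('a, 'b) pre_digraph \<Rightarrow> nat \<Rightarrow> bool" where
  "admits_identifying_code D l \<longleftrightarrow> (\<exists>C. identifying_code D l C)"

end

theory Submission
  imports Defs
begin

text \<open>
  Write \<open>f u\<close> for the only in-neighbour of \<open>u\<close>. Then \<open>N\<^sup>-[X] = X \<union> f ` X\<close>, and a directed
  walk of length \<open>k\<close> ending in \<open>u\<close> has to start in \<open>f\<^sup>k u\<close>, so that the girth is the least
  positive period of a point under \<open>f\<close> (lemma \<open>girth_less_iff_periodic\<close>). Since enlarging
  a code preserves the identifying property, the question is only whether all pairs of distinct
  nonempty sets \<open>X\<close>, \<open>Y\<close> of at most two vertices have \<open>X \<union> f ` X \<noteq> Y \<union> f ` Y\<close>.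

  A short cycle gives two such sets with the same closed in-neighbourhood, namely the vertex set of
  the cycle: it is the closed in-neighbourhood of either vertex of a digon, of any two vertices of
  a cycle of length 3, and of either pair of opposite vertices of a cycle of length 4.

  Conversely, let \<open>X \<union> f ` X = Y \<union> f ` Y\<close> and suppose that some \<open>x \<in> X\<close> is not in \<open>Y\<close>.
  Then \<open>x = f y\<close> for some \<open>y \<in> Y\<close>, and \<open>y\<close> in turn is in \<open>X\<close> or is \<open>f x'\<close> for the
  second element \<open>x'\<close> of \<open>X\<close>. In the first case the common neighbourhood is \<open>{x, y, f x}\<close>, in
  the second it is \<open>{x, x', f x, y}\<close>. In such a small set, asking how \<open>Y\<close> covers
  \<open>f x\<close> or \<open>x'\<close>, and then how \<open>X\<close> covers the second element of \<open>Y\<close> and its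
  in-neighbour, always closes up a walk of length at most 4 (lemma
  \<open>subset_if_same_image_closure\<close>).
\<close>

section \<open>Girth and closed walks\<close>

text \<open>
  A closed walk that revisits a vertex contains a strictly shorter closed walk, so that
  a shortest one is a cycle.
\<close>
lemma (in wf_digraph) closed_w_imp_shorter_cycle:
  assumes "closed_w p"
  obtains q where "cycle q" "length q \<le> length p"
proof -
  have "\<exists>q. cycle q \<and> length q \<le> length p"
    using assms
  proof (induction p rule: length_induct)
    case (1 p)
    then obtain u where u: "awalk u p u" "p \<noteq> []" by (auto simp: closed_w_def)
    show ?case
    proof (cases "distinct (tl (awalk_verts u p))")
      case True
      with u have "cycle p" by (auto simp: cycle_def)
      then show ?thesis by blast
    next
      case False
      from u obtain e es where p: "p = e # es" by (cases p) auto
      with False u have es: "awalk (head G e) es u" "\<not> distinct (awalk_verts (head G e) es)"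
        by (auto simp: awalk_Cons_iff)
      then obtain q r s where "es = q @ r @ s" "closed_w r"
        using awalk_not_distinct_decomp[OF es] by (auto simp: closed_w_def)
      moreover from this p have "length r < length p" by auto
      ultimately show ?thesis using 1(1) by (meson less_imp_le order_trans)
    qed
  qed
  with that show thesis by blast
qed

lemma (in wf_digraph) girth_less_iff_closed_walk:
  "girth G < enat n \<longleftrightarrow> (\<exists>u p. awalk u p u \<and> 0 < length p \<and> length p < n)"
proof
  assume "girth G < enat n"
  then show "\<exists>u p. awalk u p u \<and> 0 < length p \<and> length p < n"
    by (auto simp: girth_def INF_less_iff cycle_def)
next
  assume "\<exists>u p. awalk u p u \<and> 0 < length p \<and> length p < n"
  then obtain p where "closed_w p" "length p < n" by (auto simp: closed_w_def)
  then obtain q where "cycle q" "length q < n"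
    by (meson closed_w_imp_shorter_cycle le_less_trans)
  then show "girth G < enat n" by (auto simp: girth_def INF_less_iff)
qed

section \<open>The in-neighbour function\<close>

locale one_in_regular_digraph = simple_digraph +
  assumes in_regular_one: "in_regular 1 G"
begin

definition in_nbr :: "'a \<Rightarrow> 'a" where
  "in_nbr u = (THE v. v \<rightarrow> u)"

lemma in_nbhd_eq: "u \<in> verts G \<Longrightarrow> in_nbhd G u = {in_nbr u}"
proof -
  assume "u \<in> verts G"
  then have "card (in_nbhd G u) = 1" using in_regular_one by (auto simp: in_regular_def)
  then obtain v where v: "in_nbhd G u = {v}" by (auto simp: card_1_singleton_iff)
  then have "in_nbr u = v" by (auto simp: in_nbhd_def in_nbr_def)
  with v show ?thesis by simp
qed

lemma dominates_iff: "u \<in> verts G \<Longrightarrow> v \<rightarrow> u \<longleftrightarrow> v = in_nbr u"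
  using in_nbhd_eq[of u] by (auto simp: in_nbhd_def)

lemma in_nbr_in_verts: "u \<in> verts G \<Longrightarrow> in_nbr u \<in> verts G"
  using dominates_iff adj_in_verts by blast

lemma in_nbr_neq: "u \<in> verts G \<Longrightarrow> in_nbr u \<noteq> u"
  using dominates_iff adj_not_same by metis

lemma closed_in_nbhd_set_eq:
  "X \<subseteq> verts G \<Longrightarrow> closed_in_nbhd_set G X = X \<union> in_nbr ` X"
  by (auto simp: closed_in_nbhd_set_def closed_in_nbhd_def in_nbhd_eq subset_iff)

lemma awalk_imp_funpow_in_nbr: "awalk u p v \<Longrightarrow> (in_nbr ^^ length p) v = u"
proof (induction p arbitrary: u)
  case (Cons e es)
  then have "e \<in> arcs G" "tail G e = u" and IH: "(in_nbr ^^ length es) v = head G e"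
    by (auto simp: awalk_Cons_iff)
  then have "u \<rightarrow> head G e" by (auto intro: dominatesI simp: arc_to_ends_def)
  then have "u = in_nbr (head G e)" using dominates_iff adj_in_verts by blast
  with IH show ?case by simp
qed (simp add: awalk_Nil_iff)

lemma awalk_from_funpow_in_nbr:
  assumes "v \<in> verts G"
  shows "\<exists>p. awalk ((in_nbr ^^ n) v) p v \<and> length p = n"
proof (induction n)
  case 0
  then show ?case using assms by (auto simp: awalk_Nil_iff)
next
  case (Suc n)
  then obtain p where p: "awalk ((in_nbr ^^ n) v) p v" "length p = n" by blast
  then have "in_nbr ((in_nbr ^^ n) v) \<rightarrow> (in_nbr ^^ n) v"
    using dominates_iff awalk_hd_in_verts by blast
  then obtain e where "e \<in> arcs G" "tail G e = in_nbr ((in_nbr ^^ n) v)"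
      "head G e = (in_nbr ^^ n) v"
    by (rule reachableE)
  with p have "awalk ((in_nbr ^^ Suc n) v) (e # p) v" "length (e # p) = Suc n"
    by (auto simp: awalk_Cons_iff)
  then show ?case by blast
qed

lemma girth_less_iff_periodic:
  "girth G < enat n \<longleftrightarrow> (\<exists>u\<in>verts G. \<exists>k. 0 < k \<and> k < n \<and> (in_nbr ^^ k) u = u)"
  unfolding girth_less_iff_closed_walk
  by (metis awalk_imp_funpow_in_nbr awalk_from_funpow_in_nbr awalk_hd_in_verts)

end

section \<open>Codes of order two\<close>

lemma identifying_code_mono:
  assumes "identifying_code D l C" "C \<subseteq> C'" "C' \<subseteq> verts D"
  shows "identifying_code D l C'"
proof -
  have "A \<inter> C = B \<inter> C" if "A \<inter> C' = B \<inter> C'" for A B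
    using that assms(2) by blast
  with assms show ?thesis unfolding identifying_code_def by metis
qed

lemma card_between_1_2_iff: "1 \<le> card X \<and> card X \<le> 2 \<longleftrightarrow> (\<exists>a b. X = {a, b})"
proof
  assume "1 \<le> card X \<and> card X \<le> 2"
  then have "card X = 1 \<or> card X = 2" by auto
  then show "\<exists>a b. X = {a, b}" by (auto simp: card_1_singleton_iff card_2_iff)
qed (auto simp: card_insert_if)

text \<open>
  The sets \<open>X\<close> and \<open>Y\<close> of the argument are given here by elements that may coincide, which
  treats singletons and pairs alike. As the hypotheses are symmetric in the two sets, inclusion
  already gives equality. The length 4 is reached only when the preimages alternate between the
  two sets, \<open>x = f y\<close>, \<open>y = f x'\<close>, \<open>x' = f y'\<close>, \<open>y' = f x\<close>; these are the opposite pairs of a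
  cycle of length 4.
\<close>
lemma subset_if_same_image_closure:
  fixes f :: "'a \<Rightarrow> 'a"
  assumes eq: "{a, b} \<union> f ` {a, b} = {c, d} \<union> f ` {c, d}"
    and aper: "\<And>u. u \<in> {a, b, c, d} \<Longrightarrow>
      f u \<noteq> u \<and> f (f u) \<noteq> u \<and> f (f (f u)) \<noteq> u \<and> f (f (f (f u))) \<noteq> u"
  shows "{a, b} \<subseteq> {c, d}"
proof
  fix x assume x: "x \<in> {a, b}"
  show "x \<in> {c, d}"
  proof (rule ccontr)
    assume xY: "x \<notin> {c, d}"
    obtain x' where X: "{a, b} = {x, x'}" using x by blast
    have "x \<in> f ` {c, d}" using eq x xY by blast
    then obtain y where y: "y \<in> {c, d}" "x = f y" by blast
    then obtain y' where Y: "{c, d} = {y, y'}" by blast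
    have S: "{x, x', f x, f x'} = {y, y', f y, f y'}" using eq unfolding X Y by auto
    have ax: "f x \<noteq> x" "f (f x) \<noteq> x" "f (f (f x)) \<noteq> x" "f (f (f (f x))) \<noteq> x"
      and ax': "f x' \<noteq> x'" "f (f x') \<noteq> x'" "f (f (f x')) \<noteq> x'" "f (f (f (f x'))) \<noteq> x'"
      and ay: "f y \<noteq> y" "f (f y) \<noteq> y" "f (f (f y)) \<noteq> y" "f (f (f (f y))) \<noteq> y"
      and ay': "f y' \<noteq> y'" "f (f y') \<noteq> y'" "f (f (f y')) \<noteq> y'" "f (f (f (f y'))) \<noteq> y'"
      using aper X Y by blast+
    have ne: "x \<noteq> y" "x \<noteq> y'" using xY Y by auto
    have "y \<in> {x, x', f x, f x'}" using S by blast
    then consider "y = x'" | "y = f x'" unfolding insert_iff empty_iff using ne y(2) ay by metis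
    then show False
    proof cases
      case 1
      have "f x \<in> {y, y', f y, f y'}" using S by blast
      then consider "f x = y'" | "f x = f y'"
        unfolding insert_iff empty_iff using ax ay y(2) by metis
      then show False
      proof cases
        case fx: 1
        have "f y' \<in> {x, x', f x, f x'}" using S by blast
        then show False
          unfolding insert_iff empty_iff using fx 1 ax ay ay' y(2) by metis
      next
        case fx: 2
        have "y' \<in> {x, x', f x, f x'}" using S by blast
        then show False
          unfolding insert_iff empty_iff using fx 1 ax ay ay' y(2) ne by metis
      qed
    next
      case 2
      have "x' \<in> {y, y', f y, f y'}" using S by blast
      then consider "x' = y'" | "x' = x" | "x' = f y'"
        unfolding insert_iff empty_iff using 2 ax' y(2) by metis
      then show False
      proof cases
        case x': 1
        have "f x \<in> {y, y', f y, f y'}" using S by blast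
        then show False
          unfolding insert_iff empty_iff using x' 2 ax ax' ay y(2) by metis
      next
        case x': 2
        with 2 y(2) ax show False by metis
      next
        case x': 3
        have "y' \<in> {x, x', f x, f x'}" using S by blast
        \<comment> \<open>if \<open>y' = f x\<close>, then \<open>x' = f (f x)\<close> while \<open>x = f (f x')\<close>\<close>
        then show False
          unfolding insert_iff empty_iff using x' 2 ax ax' ay ay' y(2) ne by metis
      qed
    qed
  qed
qed

theorem theorem3:
  fixes D :: "('a, 'b) pre_digraph"
  assumes "simple_digraph D"
    and "in_regular 1 D"
  shows "admits_identifying_code D 2 \<longleftrightarrow> girth D \<ge> 5"
proof -
  interpret one_in_regular_digraph D
    using assms by (simp add: one_in_regular_digraph_def one_in_regular_digraph_axioms_def)
  let ?f = in_nbr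
  have girth_less: "girth D < 5 \<longleftrightarrow>
      (\<exists>u\<in>verts D. ?f u = u \<or> ?f (?f u) = u \<or> ?f (?f (?f u)) = u \<or> ?f (?f (?f (?f u))) = u)"
    (is "_ \<longleftrightarrow> (\<exists>u\<in>_. ?periodic u)")
  proof -
    have "(\<exists>k. 0 < k \<and> k < 5 \<and> P k) \<longleftrightarrow> P 1 \<or> P 2 \<or> P 3 \<or> P 4" for P :: "nat \<Rightarrow> bool"
    proof -
      have "0 < k \<and> k < 5 \<longleftrightarrow> k = 1 \<or> k = 2 \<or> k = 3 \<or> k = 4" for k :: nat by auto
      then show ?thesis by metis
    qed
    then show ?thesis
      using girth_less_iff_periodic[of 5] by (simp add: numeral_eq_enat eval_nat_numeral)
  qed
  show ?thesis
  proof
    assume "admits_identifying_code D 2"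
    then have code: "identifying_code D 2 (verts D)"
      unfolding admits_identifying_code_def
      by (meson identifying_code_def identifying_code_mono subset_refl)
    have separated: "{a, b} \<union> ?f ` {a, b} \<noteq> {c, d} \<union> ?f ` {c, d}"
      if "{a, b} \<subseteq> verts D" "{c, d} \<subseteq> verts D" "{a, b} \<noteq> {c, d}" for a b c d
      using code that card_between_1_2_iff[of "{a, b}"] card_between_1_2_iff[of "{c, d}"]
      unfolding identifying_code_def by (metis closed_in_nbhd_set_eq)
    show "girth D \<ge> 5"
    proof (rule ccontr)
      assume "\<not> girth D \<ge> 5"
      then obtain u where u: "u \<in> verts D" and "?periodic u" using girth_less by auto
      define v w z where "v = ?f u" and "w = ?f v" and "z = ?f w"
      have V: "v \<in> verts D" "w \<in> verts D" "z \<in> verts D"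
        using u by (simp_all add: v_def w_def z_def in_nbr_in_verts)
      have "v \<noteq> u" "w \<noteq> v" using u V by (simp_all add: v_def w_def in_nbr_neq)
      from \<open>?periodic u\<close> consider "w = u" | "z = u" | "?f z = u" "w \<noteq> u"
        using \<open>v \<noteq> u\<close> by (auto simp: v_def w_def z_def)
      then show False
      proof cases
        case 1
        have "{u, u} \<union> ?f ` {u, u} = {v, v} \<union> ?f ` {v, v}"
          using 1 by (auto simp: v_def w_def)
        with separated[of u u v v] u V \<open>v \<noteq> u\<close> show False by auto
      next
        case 2
        have "{u, v} \<union> ?f ` {u, v} = {v, w} \<union> ?f ` {v, w}"
          using 2 by (auto simp: v_def w_def z_def)
        moreover have "w \<noteq> u" using 2 in_nbr_neq[OF V(2)] by (auto simp: z_def)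
        ultimately show False
          using separated[of u v v w] u V \<open>v \<noteq> u\<close> by (auto simp: doubleton_eq_iff)
      next
        case 3
        have "{u, w} \<union> ?f ` {u, w} = {v, z} \<union> ?f ` {v, z}"
          using 3 by (auto simp: v_def w_def z_def)
        with separated[of u w v z] u V \<open>v \<noteq> u\<close> \<open>w \<noteq> v\<close> show False by auto
      qed
    qed
  next
    assume "girth D \<ge> 5"
    then have aper: "\<not> ?periodic u" if "u \<in> verts D" for u
      using girth_less that by (auto simp: not_less[symmetric])
    have "identifying_code D 2 (verts D)"
      unfolding identifying_code_def
    proof (intro conjI allI impI notI)
      fix X Y
      assume A: "X \<subseteq> verts D \<and> Y \<subseteq> verts D \<and> X \<noteq> Y \<and>
          1 \<le> card X \<and> card X \<le> 2 \<and> 1 \<le> card Y \<and> card Y \<le> 2"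
        and N: "closed_in_nbhd_set D X \<inter> verts D = closed_in_nbhd_set D Y \<inter> verts D"
      from A obtain a b c d where X: "X = {a, b}" and Y: "Y = {c, d}"
        by (metis card_between_1_2_iff)
      have eq: "{a, b} \<union> ?f ` {a, b} = {c, d} \<union> ?f ` {c, d}"
        using A N unfolding X Y by (auto simp: closed_in_nbhd_set_eq in_nbr_in_verts)
      have V: "{a, b, c, d} \<subseteq> verts D" using A X Y by auto
      have V': "u \<in> verts D" if "u \<in> {a, b, c, d} \<or> u \<in> {c, d, a, b}" for u
        using V that by auto
      have "{a, b} \<subseteq> {c, d}"
        using subset_if_same_image_closure[OF eq] aper[OF V'] by metis
      moreover have "{c, d} \<subseteq> {a, b}"
        using subset_if_same_image_closure[OF eq[symmetric]] aper[OF V'] by metis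
      ultimately show False using A X Y by auto
    qed simp
    then show "admits_identifying_code D 2" unfolding admits_identifying_code_def by blast
  qed
qed

end
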